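(* Let $I$ be a finite index set and let $\{S_i\}_{i\in I}$ be communicating systems, $S_i=(M_{x})_{x\in\mathbf{P}_i}$ over $\mathbf{P}_i$ and $\mathbb{A}_i$, with the sets $\mathbf{P}_i$ pairwise disjoint. Let $H=\{h_i\}_{i\in I}$ be a set of interfaces ($h_i\in\mathbf{P}_i$ for each $i$) such that each CFSM $M_{h_i}$ has no mixed states. Let $\mathbb{K}=(M_{k_i})_{i\in I}$ be a connection policy for $H$ complying with a connection model $\mathrm{CM}$ for $H$, and let $S=\mathcal{MC}(\{S_i\}_{i\in I},\mathbb{K})$ be the multicomposition. Let $\mathcal{P}$ be one of the properties deadlock-freeness, reception-error-freeness, or progress. If $\mathcal{P}$ holds for every $S_i$ ($i\in I$) and for $\mathbb{K}$, then $\mathcal{P}$ holds for $S$. Moreover, the same conclusion holds when $\mathcal{P}$ is orphan-message-freeness, even without the assumption that the interfaces $M_{h_i}$ have no mixed states.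
   Context: Participant names and messages are drawn from countably infinite sets. For a finite set $\mathbf{P}$ of participants and finite set $\mathbb{A}$ of messages, the channels are $C_{\mathbf{P}}=\{pq\mid p,q\in\mathbf{P},p\neq q\}$ and the actions are $pq!a$ (output, sending $a$ on channel $pq$; subject $p$) and $pq?a$ (input, consuming $a$ from channel $pq$; subject $q$), for $pq\in C_{\mathbf{P}}$, $a\in\mathbb{A}$. A CFSM over $\mathbf{P},\mathbb{A}$ is $M=(Q,q_0,\mathbb{A},\delta)$ with $Q$ finite, $q_0\in Q$, $\delta\subseteq Q\times \mathit{Act}\times Q$, all actions having the same subject, called the name of $M$. A state is final if it has no outgoing transition; sending (resp. receiving) if it is not final and all outgoing transitions are outputs (resp. inputs); mixed if it has an outgoing output and an outgoing input transition. $\mathrm{in}(M)$ (resp. $\mathrm{out}(M)$) is the set of messages occurring in input (resp. output) actions of $\delta$; write $\mathrm{in}(h)$, $\mathrm{out}(h)$ for the machine named $h$. A communicating system over $\mathbf{P},\mathbb{A}$ is $S=(M_p)_{p\in\mathbf{P}}$, $M_p=(Q_p,q_{0p},\mathbb{A},\delta_p)$ a CFSM named $p$. A configuration is $s=(\vec q,\vec w)$ with $\vec q=(q_p)_{p\in\mathbf P}$, $q_p\in Q_p$, and $\vec w=(w_{pq})_{pq\in C_{\mathbf P}}$, $w_{pq}\in\mathbb{A}^*$; the initial one is $((q_{0p})_p,\vec\varepsilon)$. $s\xrightarrow{l}s'$ if either $l=sr!a$, $(q_s,l,q'_s)\in\delta_s$, all other local states unchanged, $w'_{sr}=w_{sr}\cdot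 a$ and other channels unchanged; or $l=sr?a$, $(q_r,l,q'_r)\in\delta_r$, other local states unchanged, $w_{sr}=a\cdot w'_{sr}$ and other channels unchanged. $\mathsf{RC}(S)$ is the set of configurations reachable from the initial one. Properties of $S$: a configuration $s$ is a deadlock if $\vec w=\vec\varepsilon$ and every $q_p$ is a receiving state; $S$ is deadlock-free if no reachable configuration is a deadlock. $s$ is an orphan-message configuration if every $q_p$ is final and $\vec w\neq\vec\varepsilon$; $S$ is orphan-message free if none is reachable. $s$ is an unspecified reception configuration if there is $r$ with $q_r$ receiving and for all $s'$, $a$: $(q_r,s'r?a,q'_r)\in\delta_r$ implies $|w_{s'r}|>0$ and $w_{s'r}\notin a\cdot\mathbb{A}^*$; $S$ is reception-error free if none is reachable. $S$ has progress if every reachable $s$ either has some $s\to s'$ or all its local states are final. Multicomposition setting: interfaces $H=\{h_i\}_{i\in I}$ with $h_i\in\mathbf P_i$. A connection model for $H$ is $\mathrm{CM}\subseteq H\times\text{Messages}\times H$ such that for each $h\in H$ and message $a$: if $a\in\mathrm{in}(h)$ there is $h'\in H$, $h'\neq h$, with $a\in\mathrm{out}(h')$ and $(h,a,h')\in\mathrm{CM}$; if $a\in\mathrm{out}(h)$ there is $h'\neq h$ with $a\in\mathrm{in}(h')$ and $(h',a,h)\in\mathrm{CM}$; every message occurring in $\mathrm{CM}$ occurs as input or output of some interface. For each $i$ let $k_i$ be a fresh name (the "dotted" copy of $h_i$). For $M_{h_i}=(Q,q_0,\mathbb A,\delta)$, its local connection policy set w.r.t. $\mathrm{CM}$ is the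 set of CFSMs named $k_i$ of the form $(\dot Q,\dot q_0,\mathbb A,\dot\delta)$, where $\dot Q=\{\dot q\mid q\in Q\}$ is a copy of $Q$ and $\dot\delta$ is a minimal relation such that: ( * ) for every $(q,rh_i?a,q')\in\delta$ there is $j\neq i$ with $(\dot q,k_ik_j!a,\dot q')\in\dot\delta$ and $(h_i,a,h_j)\in\mathrm{CM}$; ( ** ) for every $(q,h_ir!a,q')\in\delta$ there is $j\neq i$ with $(\dot q,k_jk_i?a,\dot q')\in\dot\delta$ and $(h_j,a,h_i)\in\mathrm{CM}$. A connection policy for $H$ complying with $\mathrm{CM}$ is a communicating system $\mathbb K=(M_{k_i})_{i\in I}$ with each $M_{k_i}$ in the local connection policy set of $M_{h_i}$. Gateway: for $M_{h_i}=(Q,q_0,\mathbb A,\delta)$ and $M_{k_i}=(\dot Q,\dot q_0,\mathbb A,\dot\delta)$, the gateway $M_{h_i}\looparrowleft M_{k_i}=(Q\cup\widehat Q,q_0,\mathbb A,\widehat\delta)$, where $\widehat Q=\{q^{(q,l,q')}\mid(q,l,q')\in\delta\}$ are fresh states and $\widehat\delta$ consists of: for each $(q,h_is!a,q')\in\delta$ and each $(\dot q,k_jk_i?a,\dot q')\in\dot\delta$, the transitions $(q,h_jh_i?a,\hat q)$ and $(\hat q,h_is!a,q')$ with $\hat q=q^{(q,h_is!a,q')}$; and for each $(q,sh_i?a,q')\in\delta$ and each $(\dot q,k_ik_j!a,\dot q')\in\dot\delta$, the transitions $(q,sh_i?a,\hat q)$ and $(\hat q,h_ih_j!a,q')$ with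 $\hat q=q^{(q,sh_i?a,q')}$. The multicomposition $\mathcal{MC}(\{S_i\}_{i\in I},\mathbb K)$ is the communicating system over $\mathbf P=\bigcup_i\mathbf P_i$ and $\mathbb A=\bigcup_i\mathbb A_i$ consisting of $M_p$ for every $p\notin H$ and of $M_{h_i}\looparrowleft M_{k_i}$ in place of $M_{h_i}$ for each $i\in I$. *)

theory Defs
  imports Main "HOL-Library.Disjoint_Sets"
begin

text \<open>Participant names and messages range over arbitrary types \<open>'p\<close> and \<open>'m\<close>; only finite sets
  of them occur in a system. \<open>Send p q a\<close> is \<open>pq!a\<close> and \<open>Recv p q a\<close> is \<open>pq?a\<close>.\<close>

datatype ('p, 'm) action = is_send: Send 'p 'p 'm | is_recv: Recv 'p 'p 'm

fun subject :: "('p, 'm) action \<Rightarrow> 'p" where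
  "subject (Send p q a) = p"
| "subject (Recv p q a) = q"

definition channels :: "'p set \<Rightarrow> ('p \<times> 'p) set" where
  "channels P = {(p, q). p \<in> P \<and> q \<in> P \<and> p \<noteq> q}"

definition actions :: "'p set \<Rightarrow> 'm set \<Rightarrow> ('p, 'm) action set" where
  "actions P A =
     {Send p q a | p q a. (p, q) \<in> channels P \<and> a \<in> A} \<union>
     {Recv p q a | p q a. (p, q) \<in> channels P \<and> a \<in> A}"

text \<open>The alphabet of a machine is not a field of the record: it only bounds the actions of the
  transition relation, and is the parameter \<open>A\<close> of \<open>cfsm\<close> below.\<close>

record ('q, 'p, 'm) machine =
  states :: "'q set"
  init :: "'q"
  delta :: "('q \<times> ('p, 'm) action \<times> 'q) set"

definition cfsm :: "'p set \<Rightarrow> 'm set \<Rightarrow> 'p \<Rightarrow> ('q, 'p, 'm) machine \<Rightarrow> bool" where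
  "cfsm P A p M \<longleftrightarrow>
     finite (states M) \<and> init M \<in> states M \<and>
     delta M \<subseteq> states M \<times> actions P A \<times> states M \<and>
     (\<forall>(q, l, q') \<in> delta M. subject l = p)"

definition final :: "('q, 'p, 'm) machine \<Rightarrow> 'q \<Rightarrow> bool" where
  "final M q \<longleftrightarrow> (\<nexists>l q'. (q, l, q') \<in> delta M)"

definition sending :: "('q, 'p, 'm) machine \<Rightarrow> 'q \<Rightarrow> bool" where
  "sending M q \<longleftrightarrow> \<not> final M q \<and> (\<forall>l q'. (q, l, q') \<in> delta M \<longrightarrow> is_send l)"

definition receiving :: "('q, 'p, 'm) machine \<Rightarrow> 'q \<Rightarrow> bool" where
  "receiving M q \<longleftrightarrow> \<not> final M q \<and> (\<forall>l q'. (q, l, q') \<in> delta M \<longrightarrow> is_recv l)"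

definition mixed :: "('q, 'p, 'm) machine \<Rightarrow> 'q \<Rightarrow> bool" where
  "mixed M q \<longleftrightarrow>
     (\<exists>l q'. (q, l, q') \<in> delta M \<and> is_send l) \<and> (\<exists>l q'. (q, l, q') \<in> delta M \<and> is_recv l)"

definition no_mixed_states :: "('q, 'p, 'm) machine \<Rightarrow> bool" where
  "no_mixed_states M \<longleftrightarrow> (\<forall>q \<in> states M. \<not> mixed M q)"

definition in_msgs :: "('q, 'p, 'm) machine \<Rightarrow> 'm set" where
  "in_msgs M = {a. \<exists>q p r q'. (q, Recv p r a, q') \<in> delta M}"

definition out_msgs :: "('q, 'p, 'm) machine \<Rightarrow> 'm set" where
  "out_msgs M = {a. \<exists>q p r q'. (q, Send p r a, q') \<in> delta M}"


record ('q, 'p, 'm) system =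
  parts :: "'p set"
  msgs :: "'m set"
  mach :: "'p \<Rightarrow> ('q, 'p, 'm) machine"

definition communicating_system :: "('q, 'p, 'm) system \<Rightarrow> bool" where
  "communicating_system S \<longleftrightarrow>
     finite (parts S) \<and> finite (msgs S) \<and> (\<forall>p \<in> parts S. cfsm (parts S) (msgs S) p (mach S p))"

text \<open>The vectors of a configuration are total functions. Only their values on \<open>parts S\<close> and on
  \<open>channels (parts S)\<close> are meaningful; the others are fixed by \<open>initial\<close> and never change.
  That local states and channel contents stay within \<open>states (mach S p)\<close> and
  \<open>lists (msgs S)\<close> holds for reachable configurations, the only ones the properties refer to.\<close>

type_synonym ('q, 'p, 'm) config = "('p \<Rightarrow> 'q) \<times> ('p \<times> 'p \<Rightarrow> 'm list)"

definition initial :: "('q, 'p, 'm) system \<Rightarrow> ('q, 'p, 'm) config" where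
  "initial S = ((\<lambda>p. init (mach S p)), (\<lambda>_. []))"

inductive step ::
  "('q, 'p, 'm) system \<Rightarrow> ('q, 'p, 'm) config \<Rightarrow> ('p, 'm) action \<Rightarrow> ('q, 'p, 'm) config \<Rightarrow> bool"
  for S where
  send: "(s, r) \<in> channels (parts S) \<Longrightarrow> (q s, Send s r a, q') \<in> delta (mach S s) \<Longrightarrow>
    step S (q, w) (Send s r a) (q(s := q'), w((s, r) := w (s, r) @ [a]))"
| recv: "(s, r) \<in> channels (parts S) \<Longrightarrow> (q r, Recv s r a, q') \<in> delta (mach S r) \<Longrightarrow>
    w (s, r) = a # u \<Longrightarrow>
    step S (q, w) (Recv s r a) (q(r := q'), w((s, r) := u))"

definition RC :: "('q, 'p, 'm) system \<Rightarrow> ('q, 'p, 'm) config set" where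
  "RC S = {c. (\<lambda>c c'. \<exists>l. step S c l c')\<^sup>*\<^sup>* (initial S) c}"

definition all_final :: "('q, 'p, 'm) system \<Rightarrow> ('q, 'p, 'm) config \<Rightarrow> bool" where
  "all_final S = (\<lambda>(q, w). \<forall>p \<in> parts S. final (mach S p) (q p))"

definition deadlock :: "('q, 'p, 'm) system \<Rightarrow> ('q, 'p, 'm) config \<Rightarrow> bool" where
  "deadlock S = (\<lambda>(q, w).
     (\<forall>c \<in> channels (parts S). w c = []) \<and> (\<forall>p \<in> parts S. receiving (mach S p) (q p)))"

definition orphan_message :: "('q, 'p, 'm) system \<Rightarrow> ('q, 'p, 'm) config \<Rightarrow> bool" where
  "orphan_message S = (\<lambda>(q, w). all_final S (q, w) \<and> (\<exists>c \<in> channels (parts S). w c \<noteq> []))"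

definition unspecified_reception :: "('q, 'p, 'm) system \<Rightarrow> ('q, 'p, 'm) config \<Rightarrow> bool" where
  "unspecified_reception S = (\<lambda>(q, w).
     \<exists>r \<in> parts S. receiving (mach S r) (q r) \<and>
       (\<forall>s a q'. (q r, Recv s r a, q') \<in> delta (mach S r) \<longrightarrow>
          length (w (s, r)) > 0 \<and> w (s, r) \<notin> {a # u | u. u \<in> lists (msgs S)}))"

definition deadlock_free :: "('q, 'p, 'm) system \<Rightarrow> bool" where
  "deadlock_free S \<longleftrightarrow> (\<forall>c \<in> RC S. \<not> deadlock S c)"

definition orphan_message_free :: "('q, 'p, 'm) system \<Rightarrow> bool" where
  "orphan_message_free S \<longleftrightarrow> (\<forall>c \<in> RC S. \<not> orphan_message S c)"

definition reception_error_free :: "('q, 'p, 'm) system \<Rightarrow> bool" where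
  "reception_error_free S \<longleftrightarrow> (\<forall>c \<in> RC S. \<not> unspecified_reception S c)"

definition progress :: "('q, 'p, 'm) system \<Rightarrow> bool" where
  "progress S \<longleftrightarrow> (\<forall>c \<in> RC S. (\<exists>l c'. step S c l c') \<or> all_final S c)"


text \<open>Below, \<open>Sys\<close> is the family of systems indexed by \<open>I\<close>, \<open>h i\<close> is the interface of
  \<open>Sys i\<close>, and \<open>k i\<close> is the fresh name of its dotted copy.\<close>

definition interface_machine ::
  "('i \<Rightarrow> ('q, 'p, 'm) system) \<Rightarrow> ('i \<Rightarrow> 'p) \<Rightarrow> 'i \<Rightarrow> ('q, 'p, 'm) machine" where
  "interface_machine Sys h i = mach (Sys i) (h i)"

definition connection_model ::
  "'i set \<Rightarrow> ('i \<Rightarrow> ('q, 'p, 'm) system) \<Rightarrow> ('i \<Rightarrow> 'p) \<Rightarrow> ('p \<times> 'm \<times> 'p) set \<Rightarrow> bool" where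
  "connection_model I Sys h CM \<longleftrightarrow>
     CM \<subseteq> h ` I \<times> UNIV \<times> h ` I \<and>
     (\<forall>i \<in> I. \<forall>a \<in> in_msgs (interface_machine Sys h i).
        \<exists>j \<in> I. h j \<noteq> h i \<and> a \<in> out_msgs (interface_machine Sys h j) \<and> (h i, a, h j) \<in> CM) \<and>
     (\<forall>i \<in> I. \<forall>a \<in> out_msgs (interface_machine Sys h i).
        \<exists>j \<in> I. h j \<noteq> h i \<and> a \<in> in_msgs (interface_machine Sys h j) \<and> (h j, a, h i) \<in> CM) \<and>
     (\<forall>(x, a, y) \<in> CM. \<exists>i \<in> I.
        a \<in> in_msgs (interface_machine Sys h i) \<union> out_msgs (interface_machine Sys h i))"

datatype 'q dotted = Dot 'q

definition policy_condition ::
  "'i set \<Rightarrow> ('i \<Rightarrow> 'p) \<Rightarrow> ('i \<Rightarrow> 'p) \<Rightarrow> ('p \<times> 'm \<times> 'p) set \<Rightarrow> 'i \<Rightarrow> ('q, 'p, 'm) machine \<Rightarrow>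
   ('q dotted \<times> ('p, 'm) action \<times> 'q dotted) set \<Rightarrow> bool" where
  "policy_condition I h k CM i M D \<longleftrightarrow>
     (\<forall>q r a q'. (q, Recv r (h i) a, q') \<in> delta M \<longrightarrow>
        (\<exists>j \<in> I. j \<noteq> i \<and> (Dot q, Send (k i) (k j) a, Dot q') \<in> D \<and> (h i, a, h j) \<in> CM)) \<and>
     (\<forall>q r a q'. (q, Send (h i) r a, q') \<in> delta M \<longrightarrow>
        (\<exists>j \<in> I. j \<noteq> i \<and> (Dot q, Recv (k j) (k i) a, Dot q') \<in> D \<and> (h j, a, h i) \<in> CM))"

definition local_connection_policies ::
  "'i set \<Rightarrow> ('i \<Rightarrow> ('q, 'p, 'm) system) \<Rightarrow> ('i \<Rightarrow> 'p) \<Rightarrow> ('i \<Rightarrow> 'p) \<Rightarrow> ('p \<times> 'm \<times> 'p) set \<Rightarrow> 'i \<Rightarrow>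
   ('q dotted, 'p, 'm) machine set" where
  "local_connection_policies I Sys h k CM i =
     {N. cfsm (k ` I) (msgs (Sys i)) (k i) N \<and>
         states N = Dot ` states (interface_machine Sys h i) \<and>
         init N = Dot (init (interface_machine Sys h i)) \<and>
         policy_condition I h k CM i (interface_machine Sys h i) (delta N) \<and>
         (\<forall>D. D \<subseteq> delta N \<and> policy_condition I h k CM i (interface_machine Sys h i) D
              \<longrightarrow> D = delta N)}"

definition connection_policy ::
  "'i set \<Rightarrow> ('i \<Rightarrow> ('q, 'p, 'm) system) \<Rightarrow> ('i \<Rightarrow> 'p) \<Rightarrow> ('i \<Rightarrow> 'p) \<Rightarrow> ('p \<times> 'm \<times> 'p) set \<Rightarrow>
   ('q dotted, 'p, 'm) system \<Rightarrow> bool" where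
  "connection_policy I Sys h k CM K \<longleftrightarrow>
     communicating_system K \<and> parts K = k ` I \<and> msgs K = (\<Union>i \<in> I. msgs (Sys i)) \<and>
     (\<forall>i \<in> I. mach K (k i) \<in> local_connection_policies I Sys h k CM i)"

text \<open>States of the composed system: \<open>Orig q\<close> is an original state \<open>q\<close>, and \<open>Hat (q, l, q')\<close> is
  the fresh gateway state belonging to the transition \<open>(q, l, q')\<close>.\<close>

datatype ('q, 'p, 'm) gstate = Orig 'q | Hat "'q \<times> ('p, 'm) action \<times> 'q"

definition embed :: "('q, 'p, 'm) machine \<Rightarrow> (('q, 'p, 'm) gstate, 'p, 'm) machine" where
  "embed M = \<lparr> states = Orig ` states M, init = Orig (init M),
     delta = {(Orig q, l, Orig q') | q l q'. (q, l, q') \<in> delta M} \<rparr>"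

definition gateway ::
  "'i set \<Rightarrow> ('i \<Rightarrow> 'p) \<Rightarrow> ('i \<Rightarrow> 'p) \<Rightarrow> 'i \<Rightarrow> ('q, 'p, 'm) machine \<Rightarrow> ('q dotted, 'p, 'm) machine \<Rightarrow>
   (('q, 'p, 'm) gstate, 'p, 'm) machine" where
  "gateway I h k i M N = \<lparr>
     states = Orig ` states M \<union> Hat ` delta M,
     init = Orig (init M),
     delta =
       (\<Union>{{(Orig q, Recv (h j) (h i) a, Hat (q, Send (h i) s a, q')),
            (Hat (q, Send (h i) s a, q'), Send (h i) s a, Orig q')} | q s a q' j.
          j \<in> I \<and> (q, Send (h i) s a, q') \<in> delta M \<and>
          (Dot q, Recv (k j) (k i) a, Dot q') \<in> delta N}) \<union>
       (\<Union>{{(Orig q, Recv s (h i) a, Hat (q, Recv s (h i) a, q')),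
            (Hat (q, Recv s (h i) a, q'), Send (h i) (h j) a, Orig q')} | q s a q' j.
          j \<in> I \<and> (q, Recv s (h i) a, q') \<in> delta M \<and>
          (Dot q, Send (k i) (k j) a, Dot q') \<in> delta N}) \<rparr>"

text \<open>As the sets \<open>parts (Sys i)\<close> are pairwise disjoint, every participant of the composition
  has exactly one owner.\<close>

definition owner :: "'i set \<Rightarrow> ('i \<Rightarrow> ('q, 'p, 'm) system) \<Rightarrow> 'p \<Rightarrow> 'i" where
  "owner I Sys p = (THE i. i \<in> I \<and> p \<in> parts (Sys i))"

definition multicomposition ::
  "'i set \<Rightarrow> ('i \<Rightarrow> ('q, 'p, 'm) system) \<Rightarrow> ('i \<Rightarrow> 'p) \<Rightarrow> ('i \<Rightarrow> 'p) \<Rightarrow> ('q dotted, 'p, 'm) system \<Rightarrow>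
   (('q, 'p, 'm) gstate, 'p, 'm) system" where
  "multicomposition I Sys h k K = \<lparr>
     parts = (\<Union>i \<in> I. parts (Sys i)),
     msgs = (\<Union>i \<in> I. msgs (Sys i)),
     mach = (\<lambda>p. let i = owner I Sys p in
       if p \<in> h ` I then gateway I h k i (mach (Sys i) p) (mach K (k i))
       else embed (mach (Sys i) p)) \<rparr>"

end

theory Submission imports Defs begin

text \<open>The proof reads every reachable configuration of the composition through two kinds of views.
  A gateway state \<open>Hat (q, l, q')\<close> lies halfway through a message exchange: if \<open>l\<close> is an output, the
  message has come in from another gateway (so the dotted machine has moved to \<open>q'\<close>) but has not yet
  been forwarded (so the interface is still in \<open>q\<close>); if \<open>l\<close> is an input, it is the other way round.
  With this reading, each step of the composition is a step of exactly one \<open>Sys i\<close> or of \<open>K\<close>, and is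
  invisible to the others, so all views are reachable. Gateways that cannot move are in original
  states, where an output of the interface is an input of the dotted machine and vice versa. Hence a
  bad configuration of the composition yields a bad view: in \<open>Sys i\<close> if the interface is waiting for
  \<open>Sys i\<close>, and in \<open>K\<close> if the interfaces are waiting for each other.\<close>

section \<open>Actions as effects on a single channel\<close>

fun chan :: "('p, 'm) action \<Rightarrow> 'p \<times> 'p" where
  "chan (Send p q a) = (p, q)"
| "chan (Recv p q a) = (p, q)"

fun effect :: "('p, 'm) action \<Rightarrow> ('p \<times> 'p \<Rightarrow> 'm list) \<Rightarrow> ('p \<times> 'p \<Rightarrow> 'm list) \<Rightarrow> bool" where
  "effect (Send p q a) w w' \<longleftrightarrow> w' = w((p, q) := w (p, q) @ [a])"
| "effect (Recv p q a) w w' \<longleftrightarrow> (\<exists>u. w (p, q) = a # u \<and> w' = w((p, q) := u))"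

text \<open>Splits a step into its effect on one channel and a local transition of the subject, so
  that the two halves can be carried to a view separately.\<close>

lemma step_iff:
  "step S (q, w) l (q', w') \<longleftrightarrow>
     chan l \<in> channels (parts S) \<and> effect l w w' \<and>
     (\<exists>x. (q (subject l), l, x) \<in> delta (mach S (subject l)) \<and> q' = q(subject l := x))"
  by (cases l) (auto simp: step.simps)

lemma effect_other: "effect l w w' \<Longrightarrow> e \<noteq> chan l \<Longrightarrow> w' e = w e"
  by (cases l) auto

lemma effect_cong:
  assumes "effect l w w'" "v (chan l) = w (chan l)"
  shows "effect l v (v(chan l := w' (chan l)))"
  using assms by (cases l) auto

lemma subject_map_action: "subject (map_action f g l) = f (subject l)"
  by (cases l) auto

lemma chan_map_action: "chan (map_action f g l) = map_prod f f (chan l)"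
  by (cases l) auto

text \<open>Meant for \<open>f = h\<close> and \<open>g = k\<close>: an exchange between two
  gateways and the corresponding exchange in the policy are two renamings of one action over the
  index set.\<close>

lemma effect_map:
  assumes "effect (map_action f id l) w w'" "v (map_prod g g (chan l)) = w (map_prod f f (chan l))"
  shows "effect (map_action g id l) v
           (v(map_prod g g (chan l) := w' (map_prod f f (chan l))))"
  using assms by (cases l) auto

lemma subject_in_chan: "subject l \<in> {fst (chan l), snd (chan l)}"
  by (cases l) auto

lemma cfsm_chan: "cfsm P A p M \<Longrightarrow> (x, l, y) \<in> delta M \<Longrightarrow> chan l \<in> channels P"
  by (cases l) (fastforce simp: cfsm_def actions_def)+

lemma cfsm_subject: "cfsm P A p M \<Longrightarrow> (x, l, y) \<in> delta M \<Longrightarrow> subject l = p"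
  by (auto simp: cfsm_def)

lemma cfsm_states: "cfsm P A p M \<Longrightarrow> (x, l, y) \<in> delta M \<Longrightarrow> x \<in> states M"
  by (auto simp: cfsm_def)

lemma RC_init: "initial S \<in> RC S"
  by (simp add: RC_def)

lemma RC_step: "c \<in> RC S \<Longrightarrow> step S c l c' \<Longrightarrow> c' \<in> RC S"
  unfolding RC_def by (auto intro: rtranclp.rtrancl_into_rtrancl)

lemma RC_induct [consumes 1, case_names init step]:
  assumes "c \<in> RC S" and "P (initial S)"
    and "\<And>c l c'. c \<in> RC S \<Longrightarrow> P c \<Longrightarrow> step S c l c' \<Longrightarrow> P c'"
  shows "P c"
proof -
  have "(\<lambda>c c'. \<exists>l. step S c l c')\<^sup>*\<^sup>* (initial S) c"
    using assms(1) by (simp add: RC_def)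
  then show ?thesis
    by (induction rule: rtranclp_induct) (use assms(2,3) in \<open>auto simp: RC_def\<close>)
qed

lemma unspecified_receptionI:
  assumes "r \<in> parts S" "receiving (mach S r) (q r)"
    and "\<And>s a y. (q r, Recv s r a, y) \<in> delta (mach S r) \<Longrightarrow>
      w (s, r) \<noteq> [] \<and> w (s, r) \<notin> {a # u | u. u \<in> lists (msgs S)}"
  shows "unspecified_reception S (q, w)"
  unfolding unspecified_reception_def prod.case length_greater_0_conv using assms by blast

section \<open>The two readings of a gateway state\<close>

fun sys_state :: "('q, 'p, 'm) gstate \<Rightarrow> 'q" where
  "sys_state (Orig q) = q"
| "sys_state (Hat (q, l, q')) = (if is_send l then q else q')"

fun pol_state :: "('q, 'p, 'm) gstate \<Rightarrow> 'q dotted" where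
  "pol_state (Orig q) = Dot q"
| "pol_state (Hat (q, l, q')) = Dot (if is_send l then q' else q)"

section \<open>Participants, channels and machines of the composition\<close>

locale multicomp =
  fixes I :: "'i set"
    and Sys :: "'i \<Rightarrow> ('q, 'p, 'm) system"
    and h k :: "'i \<Rightarrow> 'p"
    and CM :: "('p \<times> 'm \<times> 'p) set"
    and K :: "('q dotted, 'p, 'm) system"
  assumes systems: "\<And>i. i \<in> I \<Longrightarrow> communicating_system (Sys i)"
    and disj: "disjoint_family_on (\<lambda>i. parts (Sys i)) I"
    and h_parts: "\<And>i. i \<in> I \<Longrightarrow> h i \<in> parts (Sys i)"
    and inj_k: "inj_on k I"
    and policy: "connection_policy I Sys h k CM K"
begin

abbreviation "MC \<equiv> multicomposition I Sys h k K"

abbreviation "M i \<equiv> mach (Sys i) (h i)"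

abbreviation "N i \<equiv> mach K (k i)"

lemma same_owner: "i \<in> I \<Longrightarrow> j \<in> I \<Longrightarrow> p \<in> parts (Sys i) \<Longrightarrow> p \<in> parts (Sys j) \<Longrightarrow> i = j"
  using disj by (auto simp: disjoint_family_on_def)

lemma h_in_parts_iff: "i \<in> I \<Longrightarrow> j \<in> I \<Longrightarrow> h j \<in> parts (Sys i) \<longleftrightarrow> j = i"
  using same_owner h_parts by blast

lemma h_eq_iff: "i \<in> I \<Longrightarrow> j \<in> I \<Longrightarrow> h i = h j \<longleftrightarrow> i = j"
  using h_in_parts_iff h_parts by metis

lemma k_eq_iff: "i \<in> I \<Longrightarrow> j \<in> I \<Longrightarrow> k i = k j \<longleftrightarrow> i = j"
  using inj_k by (auto simp: inj_on_def)

lemma owner_eq: "i \<in> I \<Longrightarrow> p \<in> parts (Sys i) \<Longrightarrow> owner I Sys p = i"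
  unfolding owner_def using same_owner by blast

lemma parts_MC: "parts MC = (\<Union>i\<in>I. parts (Sys i))"
  and msgs_MC: "msgs MC = (\<Union>i\<in>I. msgs (Sys i))"
  by (simp_all add: multicomposition_def)

lemma parts_K: "parts K = k ` I"
  and msgs_K: "msgs K = msgs MC"
  using policy by (simp_all add: connection_policy_def msgs_MC)

lemma channels_sys_MC: "i \<in> I \<Longrightarrow> e \<in> channels (parts (Sys i)) \<Longrightarrow> e \<in> channels (parts MC)"
  by (auto simp: channels_def parts_MC)

lemma channels_h_MC: "i \<in> I \<Longrightarrow> j \<in> I \<Longrightarrow> i \<noteq> j \<Longrightarrow> (h i, h j) \<in> channels (parts MC)"
  using h_parts by (auto simp: channels_def parts_MC h_eq_iff)

lemma mach_MC_local:
  "i \<in> I \<Longrightarrow> p \<in> parts (Sys i) \<Longrightarrow> p \<noteq> h i \<Longrightarrow> mach MC p = embed (mach (Sys i) p)"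
  using h_in_parts_iff by (auto simp: multicomposition_def owner_eq Let_def)

lemma mach_MC_h: "i \<in> I \<Longrightarrow> mach MC (h i) = gateway I h k i (M i) (N i)"
  by (auto simp: multicomposition_def owner_eq h_parts Let_def)

lemma cfsm_sys: "i \<in> I \<Longrightarrow> p \<in> parts (Sys i) \<Longrightarrow> cfsm (parts (Sys i)) (msgs (Sys i)) p (mach (Sys i) p)"
  using systems by (auto simp: communicating_system_def)

lemma cfsm_M: "i \<in> I \<Longrightarrow> cfsm (parts (Sys i)) (msgs (Sys i)) (h i) (M i)"
  by (rule cfsm_sys[OF _ h_parts])

section \<open>Dotted machines and gateways compared with their interfaces\<close>

lemma N_policy: "i \<in> I \<Longrightarrow> N i \<in> local_connection_policies I Sys h k CM i"
  using policy by (simp add: connection_policy_def)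

lemma cfsm_N: "i \<in> I \<Longrightarrow> cfsm (k ` I) (msgs (Sys i)) (k i) (N i)"
  using N_policy by (auto simp: local_connection_policies_def)

lemma recv_M_N:
  assumes "i \<in> I" "(q, Recv r (h i) a, q') \<in> delta (M i)"
  shows "\<exists>j\<in>I. j \<noteq> i \<and> (Dot q, Send (k i) (k j) a, Dot q') \<in> delta (N i)"
  using N_policy[OF assms(1)] assms(2)
  unfolding local_connection_policies_def policy_condition_def interface_machine_def by blast

lemma send_M_N:
  assumes "i \<in> I" "(q, Send (h i) r a, q') \<in> delta (M i)"
  shows "\<exists>j\<in>I. j \<noteq> i \<and> (Dot q, Recv (k j) (k i) a, Dot q') \<in> delta (N i)"
  using N_policy[OF assms(1)] assms(2)
  unfolding local_connection_policies_def policy_condition_def interface_machine_def by blast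

text \<open>An upper bound for \<open>delta (N i)\<close>: the mirror images, with polarity
  exchanged and an arbitrary partner \<open>j\<close>, of the interface transitions.\<close>

definition justified :: "'i \<Rightarrow> ('q dotted \<times> ('p, 'm) action \<times> 'q dotted) set" where
  "justified i =
     {(Dot q, Send (k i) (k j) a, Dot q') | q j a q'.
        j \<in> I \<and> j \<noteq> i \<and> (\<exists>r. (q, Recv r (h i) a, q') \<in> delta (M i))} \<union>
     {(Dot q, Recv (k j) (k i) a, Dot q') | q j a q'.
        j \<in> I \<and> j \<noteq> i \<and> (\<exists>r. (q, Send (h i) r a, q') \<in> delta (M i))}"

text \<open>By minimality: the transitions demanded by \<open>policy_condition\<close> are all
  justified, so cutting \<open>delta (N i)\<close> down to \<open>justified i\<close> preserves the
  condition and hence removes nothing.\<close>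

lemma delta_N_justified:
  assumes i: "i \<in> I"
  shows "delta (N i) \<subseteq> justified i"
proof -
  let ?D = "delta (N i) \<inter> justified i"
  have pc: "policy_condition I h k CM i (M i) (delta (N i))"
    using N_policy[OF i] by (simp add: local_connection_policies_def interface_machine_def)
  have "policy_condition I h k CM i (M i) ?D"
    unfolding policy_condition_def
  proof (intro conjI allI impI)
    fix q r a q' assume t: "(q, Recv r (h i) a, q') \<in> delta (M i)"
    then obtain j where "j \<in> I" "j \<noteq> i" "(Dot q, Send (k i) (k j) a, Dot q') \<in> delta (N i)"
      "(h i, a, h j) \<in> CM"
      using pc unfolding policy_condition_def by blast
    with t show "\<exists>j\<in>I. j \<noteq> i \<and> (Dot q, Send (k i) (k j) a, Dot q') \<in> ?D \<and> (h i, a, h j) \<in> CM"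
      unfolding justified_def by blast
  next
    fix q r a q' assume t: "(q, Send (h i) r a, q') \<in> delta (M i)"
    then obtain j where "j \<in> I" "j \<noteq> i" "(Dot q, Recv (k j) (k i) a, Dot q') \<in> delta (N i)"
      "(h j, a, h i) \<in> CM"
      using pc unfolding policy_condition_def by blast
    with t show "\<exists>j\<in>I. j \<noteq> i \<and> (Dot q, Recv (k j) (k i) a, Dot q') \<in> ?D \<and> (h j, a, h i) \<in> CM"
      unfolding justified_def by blast
  qed
  then have "?D = delta (N i)"
    using N_policy[OF i] by (simp add: local_connection_policies_def interface_machine_def)
  then show ?thesis by blast
qed

lemma delta_N_cases:
  assumes "i \<in> I" "(x, l, y) \<in> delta (N i)"
  obtains (send) q j a q' r where "x = Dot q" "y = Dot q'" "l = Send (k i) (k j) a" "j \<in> I" "j \<noteq> i"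
      "(q, Recv r (h i) a, q') \<in> delta (M i)"
    | (recv) q j a q' r where "x = Dot q" "y = Dot q'" "l = Recv (k j) (k i) a" "j \<in> I" "j \<noteq> i"
      "(q, Send (h i) r a, q') \<in> delta (M i)"
  using subsetD[OF delta_N_justified[OF assms(1)] assms(2)] unfolding justified_def
  by (elim UnE CollectE exE conjE Pair_inject) ((rule send; assumption), (rule recv; assumption))

text \<open>The policy clauses yield a dotted transition for each interface transition;
  \<open>delta_N_cases\<close>, hence minimality, yields the converse.\<close>

lemma N_polarity:
  assumes "i \<in> I"
  shows "(\<exists>l y. (Dot q, l, y) \<in> delta (N i) \<and> is_send l) \<longleftrightarrow> (\<exists>l y. (q, l, y) \<in> delta (M i) \<and> is_recv l)"
    and "(\<exists>l y. (Dot q, l, y) \<in> delta (N i) \<and> is_recv l) \<longleftrightarrow> (\<exists>l y. (q, l, y) \<in> delta (M i) \<and> is_send l)"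
proof -
  have 1: "\<exists>r. l = Recv r (h i) a" if "(q, l, y) \<in> delta (M i)" "l = Recv s t a" for l y s t a
    using cfsm_subject[OF cfsm_M that(1)] assms that by auto
  have 2: "\<exists>r. l = Send (h i) r a" if "(q, l, y) \<in> delta (M i)" "l = Send s t a" for l y s t a
    using cfsm_subject[OF cfsm_M that(1)] assms that by auto
  show "(\<exists>l y. (Dot q, l, y) \<in> delta (N i) \<and> is_send l) \<longleftrightarrow> (\<exists>l y. (q, l, y) \<in> delta (M i) \<and> is_recv l)"
    using recv_M_N[OF assms] 1 delta_N_cases[OF assms]
    by (smt (verit) action.collapse(2) action.disc(1,3,4) dotted.inject is_recv_def is_send_def)
  show "(\<exists>l y. (Dot q, l, y) \<in> delta (N i) \<and> is_recv l) \<longleftrightarrow> (\<exists>l y. (q, l, y) \<in> delta (M i) \<and> is_send l)"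
    using send_M_N[OF assms] 2 delta_N_cases[OF assms]
    by (smt (verit) action.collapse(2) action.disc(1,3,4) dotted.inject is_recv_def is_send_def)
qed

text \<open>Every gateway transition is one half of a relay. In a case name, the first word is the
  direction of the gateway action and the second that of the interface transition being served. So
  \<open>in_out\<close> and \<open>out_in\<close> face another gateway, while \<open>out_out\<close>
  and \<open>in_in\<close> face \<open>Sys i\<close>.\<close>

lemma gateway_cases:
  assumes i: "i \<in> I" and t: "(x, l, y) \<in> delta (mach MC (h i))"
  obtains
    (in_out) q s a q' j where "j \<in> I" "j \<noteq> i" "(q, Send (h i) s a, q') \<in> delta (M i)"
      "(Dot q, Recv (k j) (k i) a, Dot q') \<in> delta (N i)"
      "x = Orig q" "l = Recv (h j) (h i) a" "y = Hat (q, Send (h i) s a, q')"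
  | (out_out) q s a q' where "(q, Send (h i) s a, q') \<in> delta (M i)"
      "x = Hat (q, Send (h i) s a, q')" "l = Send (h i) s a" "y = Orig q'"
  | (in_in) q s a q' where "(q, Recv s (h i) a, q') \<in> delta (M i)"
      "x = Orig q" "l = Recv s (h i) a" "y = Hat (q, Recv s (h i) a, q')"
  | (out_in) q s a q' j where "j \<in> I" "j \<noteq> i" "(q, Recv s (h i) a, q') \<in> delta (M i)"
      "(Dot q, Send (k i) (k j) a, Dot q') \<in> delta (N i)"
      "x = Hat (q, Recv s (h i) a, q')" "l = Send (h i) (h j) a" "y = Orig q'"
proof -
  \<comment> \<open>\<open>gateway\<close> lets \<open>j\<close> range over all of \<open>I\<close>;
    the two ends of an action of \<open>N i\<close> differ because they form a channel.\<close>
  have ne: "j \<noteq> i" if "(u, l, v) \<in> delta (N i)" "chan l \<in> {(k i, k j), (k j, k i)}" for j l u v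
    using cfsm_chan[OF cfsm_N[OF i] that(1)] that(2) by (auto simp: channels_def)
  from t have
    "(\<exists>q s a q' j. j \<in> I \<and> (q, Send (h i) s a, q') \<in> delta (M i) \<and>
        (Dot q, Recv (k j) (k i) a, Dot q') \<in> delta (N i) \<and>
        ((x, l, y) = (Orig q, Recv (h j) (h i) a, Hat (q, Send (h i) s a, q')) \<or>
         (x, l, y) = (Hat (q, Send (h i) s a, q'), Send (h i) s a, Orig q'))) \<or>
     (\<exists>q s a q' j. j \<in> I \<and> (q, Recv s (h i) a, q') \<in> delta (M i) \<and>
        (Dot q, Send (k i) (k j) a, Dot q') \<in> delta (N i) \<and>
        ((x, l, y) = (Orig q, Recv s (h i) a, Hat (q, Recv s (h i) a, q')) \<or>
         (x, l, y) = (Hat (q, Recv s (h i) a, q'), Send (h i) (h j) a, Orig q')))"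
    unfolding mach_MC_h[OF i] gateway_def machine.simps Un_iff Union_iff mem_Collect_eq
    by (elim disjE bexE CollectE exE conjE) blast+
  then show thesis
  proof (elim disjE exE conjE Pair_inject)
    fix q s a q' j
    assume "j \<in> I" and m: "(q, Send (h i) s a, q') \<in> delta (M i)"
      and n: "(Dot q, Recv (k j) (k i) a, Dot q') \<in> delta (N i)"
    note * = this
    show thesis if "x = Orig q" "l = Recv (h j) (h i) a" "y = Hat (q, Send (h i) s a, q')"
      using in_out[OF *(1) ne[OF n] m n] that by simp
    show thesis if "x = Hat (q, Send (h i) s a, q')" "l = Send (h i) s a" "y = Orig q'"
      using out_out[OF m] that by simp
  next
    fix q s a q' j
    assume "j \<in> I" and m: "(q, Recv s (h i) a, q') \<in> delta (M i)"
      and n: "(Dot q, Send (k i) (k j) a, Dot q') \<in> delta (N i)"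
    note * = this
    show thesis if "x = Orig q" "l = Recv s (h i) a" "y = Hat (q, Recv s (h i) a, q')"
      using in_in[OF m] that by simp
    show thesis if "x = Hat (q, Recv s (h i) a, q')" "l = Send (h i) (h j) a" "y = Orig q'"
      using out_in[OF *(1) ne[OF n] m n] that by simp
  qed
qed

lemma gateway_send_transitions:
  assumes "i \<in> I" "j \<in> I" "(q, Send (h i) s a, q') \<in> delta (M i)"
    "(Dot q, Recv (k j) (k i) a, Dot q') \<in> delta (N i)"
  shows "{(Orig q, Recv (h j) (h i) a, Hat (q, Send (h i) s a, q')),
          (Hat (q, Send (h i) s a, q'), Send (h i) s a, Orig q')} \<subseteq> delta (mach MC (h i))"
  unfolding mach_MC_h[OF assms(1)] gateway_def machine.simps
  by (rule subset_trans[OF Union_upper Un_upper1]) (use assms in blast)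

lemma gateway_recv_transitions:
  assumes "i \<in> I" "j \<in> I" "(q, Recv s (h i) a, q') \<in> delta (M i)"
    "(Dot q, Send (k i) (k j) a, Dot q') \<in> delta (N i)"
  shows "{(Orig q, Recv s (h i) a, Hat (q, Recv s (h i) a, q')),
          (Hat (q, Recv s (h i) a, q'), Send (h i) (h j) a, Orig q')} \<subseteq> delta (mach MC (h i))"
  unfolding mach_MC_h[OF assms(1)] gateway_def machine.simps
  by (rule subset_trans[OF Union_upper Un_upper2]) (use assms in blast)

lemma gateway_recv:
  assumes "i \<in> I" "(q, Recv s (h i) a, q') \<in> delta (M i)"
  shows "(Orig q, Recv s (h i) a, Hat (q, Recv s (h i) a, q')) \<in> delta (mach MC (h i))"
  using recv_M_N[OF assms] gateway_recv_transitions[OF assms(1) _ assms(2)] by blast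

text \<open>The interface output that the gateway needs for this input exists by minimality of the
  policy, through \<open>delta_N_cases\<close>.\<close>

lemma gateway_recv_N:
  assumes "i \<in> I" "j \<in> I" "(Dot q, Recv (k j) (k i) a, y) \<in> delta (N i)"
  shows "\<exists>y'. (Orig q, Recv (h j) (h i) a, y') \<in> delta (mach MC (h i))"
  using assms(1,3)
proof (cases rule: delta_N_cases)
  case (recv q1 j1 a1 q' r)
  then show ?thesis
    using gateway_send_transitions[OF assms(1,2)] assms(3) by blast
qed auto

text \<open>An \<open>Orig\<close> state offers only first halves of relays, and the policy makes
  every interface transition start at least one.\<close>

lemma gateway_final: "i \<in> I \<Longrightarrow> final (mach MC (h i)) (Orig q) \<longleftrightarrow> final (M i) q"
proof
  assume i: "i \<in> I" and f: "final (M i) q"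
  show "final (mach MC (h i)) (Orig q)"
    unfolding final_def
  proof (intro notI, elim exE)
    fix l y assume "(Orig q, l, y) \<in> delta (mach MC (h i))"
    with i show False
      by (cases rule: gateway_cases) (use f in \<open>auto simp: final_def\<close>)
  qed
next
  assume i: "i \<in> I" and f: "final (mach MC (h i)) (Orig q)"
  show "final (M i) q"
    unfolding final_def
  proof (intro notI, elim exE)
    fix l q' assume t: "(q, l, q') \<in> delta (M i)"
    show False
    proof (cases l)
      case (Send s r a)
      with cfsm_subject[OF cfsm_M t] i t have "(q, Send (h i) r a, q') \<in> delta (M i)" by auto
      from send_M_N[OF i this] gateway_recv_N[OF i] f show False by (meson final_def)
    next
      case (Recv s r a)
      with cfsm_subject[OF cfsm_M t] i t have "(q, Recv s (h i) a, q') \<in> delta (M i)" by auto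
      from gateway_recv[OF i this] f show False by (meson final_def)
    qed
  qed
qed

lemma final_N: "i \<in> I \<Longrightarrow> final (N i) (Dot q) \<longleftrightarrow> final (M i) q"
  using N_polarity[of i q] unfolding final_def by (meson action.exhaust_disc)

lemma local_delta:
  "i \<in> I \<Longrightarrow> p \<in> parts (Sys i) \<Longrightarrow> p \<noteq> h i \<Longrightarrow>
     (x, l, y) \<in> delta (mach MC p) \<longleftrightarrow>
     (\<exists>q q'. x = Orig q \<and> y = Orig q' \<and> (q, l, q') \<in> delta (mach (Sys i) p))"
  by (auto simp: mach_MC_local embed_def)

section \<open>Views of a configuration and their reachability\<close>

definition sys_view where
  "sys_view i c c' \<longleftrightarrow>
     (\<forall>p \<in> parts (Sys i). fst c' p = sys_state (fst c p)) \<and>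
     (\<forall>e \<in> channels (parts (Sys i)). snd c' e = snd c e)"

text \<open>A relation, like \<open>sys_view\<close>: configurations are total functions, and a view
  is determined only on the participants and channels of its own system.\<close>

definition pol_view where
  "pol_view c c' \<longleftrightarrow>
     (\<forall>i \<in> I. fst c' (k i) = pol_state (fst c (h i))) \<and>
     (\<forall>i \<in> I. \<forall>j \<in> I. i \<noteq> j \<longrightarrow> snd c' (k i, k j) = snd c (h i, h j))"

definition gateway_channel where
  "gateway_channel e \<longleftrightarrow> (\<exists>i \<in> I. \<exists>j \<in> I. i \<noteq> j \<and> e = (h i, h j))"

text \<open>Supplies what the views do not record. The first clause shows that receiving, final or
  stuck machines are in \<open>Orig\<close> states; the second places every pending message in some
  view.\<close>

definition well_formed where
  "well_formed c \<longleftrightarrow>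
     (\<forall>i \<in> I. \<forall>p \<in> parts (Sys i). fst c p \<in> range Orig \<or>
        p = h i \<and> (\<exists>l x. is_send l \<and> (fst c p, l, x) \<in> delta (mach MC p))) \<and>
     (\<forall>e. snd c e \<noteq> [] \<longrightarrow> (\<exists>i \<in> I. e \<in> channels (parts (Sys i))) \<or> gateway_channel e)"

lemma not_gateway_channel: "i \<in> I \<Longrightarrow> e \<in> channels (parts (Sys i)) \<Longrightarrow> \<not> gateway_channel e"
  using h_in_parts_iff by (auto simp: gateway_channel_def channels_def)

lemma sys_channel_unique:
  "i \<in> I \<Longrightarrow> j \<in> I \<Longrightarrow> e \<in> channels (parts (Sys i)) \<Longrightarrow> e \<in> channels (parts (Sys j)) \<Longrightarrow> i = j"
  using same_owner by (auto simp: channels_def)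

text \<open>The case split behind both simulations. In \<open>external\<close> the action is
  represented by \<open>l0\<close> over the indices, because the composition names its ends by
  \<open>h\<close> and the policy by \<open>k\<close>.\<close>

lemma transition_cases:
  assumes "p \<in> parts MC" "(x, l, y) \<in> delta (mach MC p)"
  obtains
    (internal) i where "i \<in> I" "p \<in> parts (Sys i)" "subject l = p" "chan l \<in> channels (parts (Sys i))"
      "(sys_state x, l, sys_state y) \<in> delta (mach (Sys i) p)" "p \<in> h ` I \<Longrightarrow> pol_state y = pol_state x"
  | (external) i l0 where "i \<in> I" "p = h i" "subject l0 = i" "chan l0 \<in> channels I"
      "l = map_action h id l0" "(pol_state x, map_action k id l0, pol_state y) \<in> delta (N i)"
      "sys_state y = sys_state x"
proof -
  obtain i where i: "i \<in> I" and p: "p \<in> parts (Sys i)" using assms(1) by (auto simp: parts_MC)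
  show thesis
  proof (cases "p = h i")
    case False
    then obtain q q' where t: "x = Orig q" "y = Orig q'" "(q, l, q') \<in> delta (mach (Sys i) p)"
      using assms(2) local_delta[OF i p] by auto
    moreover have "p \<notin> h ` I" using False p i h_in_parts_iff by auto
    ultimately show thesis
      using internal[OF i p] cfsm_subject[OF cfsm_sys[OF i p]] cfsm_chan[OF cfsm_sys[OF i p]] by simp
  next
    case True
    \<comment> \<open>Covers \<open>out_out\<close> and \<open>in_in\<close>, the halves exchanged
      inside \<open>Sys i\<close>, where both ends have the same \<open>pol_state\<close>.\<close>
    have int: thesis if "(sys_state x, l, sys_state y) \<in> delta (M i)" "pol_state y = pol_state x"
      using internal[OF i p] cfsm_subject[OF cfsm_M[OF i] that(1)]
        cfsm_chan[OF cfsm_M[OF i] that(1)] that True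
      by simp
    from i assms(2)[unfolded True] show thesis
    proof (cases rule: gateway_cases)
      case (in_out q s a q' j)
      then show thesis using i True
        by (intro external[of i "Recv j i a"]) (auto simp: channels_def)
    next
      case (out_in q s a q' j)
      then show thesis using i True
        by (intro external[of i "Send i j a"]) (auto simp: channels_def)
    qed (auto intro: int)
  qed
qed

text \<open>A simulation with stuttering: internal steps of \<open>Sys i\<close> are copied, all
  other steps leave the view as it is.\<close>

lemma sys_view_reachable:
  assumes "i \<in> I" "c \<in> RC MC"
  shows "\<exists>c' \<in> RC (Sys i). sys_view i c c'"
  using assms(2)
proof (induction rule: RC_induct)
  case init
  have "sys_state (init (mach MC p)) = init (mach (Sys i) p)" if "p \<in> parts (Sys i)" for p
  proof (cases "p = h i")
    case True then show ?thesis by (simp add: mach_MC_h[OF assms(1)] gateway_def)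
  next
    case False then show ?thesis by (simp add: mach_MC_local[OF assms(1) that] embed_def)
  qed
  then have "sys_view i (initial MC) (initial (Sys i))"
    by (simp add: sys_view_def initial_def)
  then show ?case using RC_init by blast
next
  case (step c l d)
  then obtain v u where vu: "(v, u) \<in> RC (Sys i)" "sys_view i c (v, u)" by auto
  obtain q w q' w' where c: "c = (q, w)" "d = (q', w')" by (cases c, cases d) auto
  from step(2)[unfolded c step_iff] obtain x where
    l: "chan l \<in> channels (parts MC)" "effect l w w'" and
    x: "(q (subject l), l, x) \<in> delta (mach MC (subject l))" "q' = q(subject l := x)" by auto
  have "subject l \<in> parts MC" using l(1) subject_in_chan[of l] by (auto simp: channels_def)
  from this x(1) show ?case
  proof (cases rule: transition_cases)
    case (internal j)
    show ?thesis
    proof (cases "j = i")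
      case True
      \<comment> \<open>The view takes over the new content of the composed channel; this is a
        genuine step because \<open>u\<close> and \<open>w\<close> agree on \<open>chan l\<close>
        beforehand.\<close>
      let ?d = "(v(subject l := sys_state x), u(chan l := w' (chan l)))"
      have "u (chan l) = w (chan l)" "v (subject l) = sys_state (q (subject l))"
        using vu(2) internal c True by (auto simp: sys_view_def)
      then have "step (Sys i) (v, u) l ?d"
        using internal True l effect_cong by (auto simp: step_iff)
      moreover have "sys_view i d ?d"
        using vu(2) c x(2) effect_other[OF l(2)] by (auto simp: sys_view_def)
      ultimately show ?thesis using vu(1) RC_step by blast
    next
      case False
      then have "subject l \<notin> parts (Sys i)" "chan l \<notin> channels (parts (Sys i))"
        using internal assms(1) same_owner sys_channel_unique by blast+
      moreover from this(2) have "w' e = w e" if "e \<in> channels (parts (Sys i))" for e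
        using effect_other[OF l(2)] that by metis
      ultimately have "sys_view i d (v, u)"
        using vu(2) c x(2) by (auto simp: sys_view_def)
      then show ?thesis using vu(1) by blast
    qed
  next
    case (external j l0)
    \<comment> \<open>An external action uses a channel between two interfaces; these have different
      owners, so the channel lies inside no single system.\<close>
    then have "gateway_channel (chan l)"
      by (cases "chan l0") (auto simp: gateway_channel_def chan_map_action channels_def)
    then have "chan l \<notin> channels (parts (Sys i))"
      using not_gateway_channel[OF assms(1)] by blast
    then have "w' e = w e" if "e \<in> channels (parts (Sys i))" for e
      using effect_other[OF l(2)] that by metis
    then have "sys_view i d (v, u)"
      using vu(2) c x(2) external by (auto simp: sys_view_def)
    then show ?thesis using vu(1) by blast
  qed
qed

text \<open>The dual simulation: external steps are copied, internal ones stutter.\<close>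

lemma pol_view_reachable:
  assumes "c \<in> RC MC"
  shows "\<exists>c' \<in> RC K. pol_view c c'"
  using assms
proof (induction rule: RC_induct)
  case init
  have "init (N i) = pol_state (init (mach MC (h i)))" if "i \<in> I" for i
    using N_policy[OF that]
    by (simp add: mach_MC_h[OF that] gateway_def local_connection_policies_def interface_machine_def)
  then have "pol_view (initial MC) (initial K)"
    by (simp add: pol_view_def initial_def)
  then show ?case using RC_init by blast
next
  case (step c l d)
  then obtain v u where vu: "(v, u) \<in> RC K" "pol_view c (v, u)" by auto
  obtain q w q' w' where c: "c = (q, w)" "d = (q', w')" by (cases c, cases d) auto
  from step(2)[unfolded c step_iff] obtain x where
    l: "chan l \<in> channels (parts MC)" "effect l w w'" and
    x: "(q (subject l), l, x) \<in> delta (mach MC (subject l))" "q' = q(subject l := x)" by auto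
  have "subject l \<in> parts MC" using l(1) subject_in_chan[of l] by (auto simp: channels_def)
  from this x(1) show ?case
  proof (cases rule: transition_cases)
    case (internal j)
    then have "\<not> gateway_channel (chan l)" using not_gateway_channel by blast
    then have "w' (h i1, h i2) = w (h i1, h i2)" if "i1 \<in> I" "i2 \<in> I" "i1 \<noteq> i2" for i1 i2
      using effect_other[OF l(2)] that unfolding gateway_channel_def by metis
    \<comment> \<open>An internal step may move an interface, but only between gateway states with
      the same policy reading.\<close>
    moreover have "pol_state (q' (h i)) = pol_state (q (h i))" if "i \<in> I" for i
      using internal(6) x(2) that by (cases "h i = subject l") (metis fun_upd_apply image_eqI)+
    ultimately have "pol_view d (v, u)"
      using vu(2) c by (simp add: pol_view_def)
    then show ?thesis using vu(1) by blast
  next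
    case (external i l0)
    obtain i1 i2 where ch: "chan l0 = (i1, i2)" "i1 \<in> I" "i2 \<in> I" "i1 \<noteq> i2"
      using external(4) by (auto simp: channels_def)
    \<comment> \<open>The index pair \<open>(i1, i2)\<close> translates the written channel from
      \<open>h\<close> to \<open>k\<close>. Injectivity of both on \<open>I\<close> keeps the
      updates on the two sides aligned.\<close>
    let ?d = "(v(k i := pol_state x), u((k i1, k i2) := w' (h i1, h i2)))"
    have "u (k i1, k i2) = w (h i1, h i2)" "v (k i) = pol_state (q (h i))"
      using vu(2) external c ch by (auto simp: pol_view_def)
    then have "step K (v, u) (map_action k id l0) ?d"
      using external l ch effect_map[of h l0 w w' u k]
      by (auto simp: step_iff subject_map_action chan_map_action parts_K channels_def k_eq_iff)
    moreover have "pol_view d ?d"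
      using vu(2) c x(2) effect_other[OF l(2)] external ch
      by (auto simp: pol_view_def k_eq_iff h_eq_iff chan_map_action subject_map_action)
    ultimately show ?thesis using vu(1) RC_step by blast
  qed
qed

text \<open>A relay once begun can be completed: towards \<open>Sys i\<close> after
  \<open>in_out\<close>, and towards a partner provided by the policy after
  \<open>in_in\<close>.\<close>

lemma gateway_hat_sends:
  assumes i: "i \<in> I" and t: "(x, l, y) \<in> delta (mach MC (h i))"
  shows "y \<in> range Orig \<or> (\<exists>l z. is_send l \<and> (y, l, z) \<in> delta (mach MC (h i)))"
  using i t
proof (cases rule: gateway_cases)
  case (in_out q s a q' j)
  then have "(y, Send (h i) s a, Orig q') \<in> delta (mach MC (h i))"
    using gateway_send_transitions[OF i] by blast
  then show ?thesis by (intro disjI2 exI[of _ "Send (h i) s a"]) auto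
next
  case (in_in q s a q')
  then obtain j where "j \<in> I" "(Dot q, Send (k i) (k j) a, Dot q') \<in> delta (N i)"
    using recv_M_N[OF i] by blast
  with in_in have "(y, Send (h i) (h j) a, Orig q') \<in> delta (mach MC (h i))"
    using gateway_recv_transitions[OF i] by blast
  then show ?thesis by (intro disjI2 exI[of _ "Send (h i) (h j) a"]) auto
qed auto

lemma well_formed_reachable: "c \<in> RC MC \<Longrightarrow> well_formed c"
proof (induction rule: RC_induct)
  case init
  have "init (mach MC p) \<in> range Orig" if "i \<in> I" "p \<in> parts (Sys i)" for i p
    using mach_MC_h[OF that(1)] mach_MC_local[OF that]
    by (cases "p = h i") (auto simp: gateway_def embed_def)
  then show ?case by (auto simp: well_formed_def initial_def)
next
  case (step c l d)
  obtain q w q' w' where c: "c = (q, w)" "d = (q', w')" by (cases c, cases d) auto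
  from step(2)[unfolded c step_iff] obtain x where
    l: "chan l \<in> channels (parts MC)" "effect l w w'" and
    x: "(q (subject l), l, x) \<in> delta (mach MC (subject l))" "q' = q(subject l := x)" by auto
  have s: "subject l \<in> parts MC" using l(1) subject_in_chan[of l] by (auto simp: channels_def)
  \<comment> \<open>Channel contents change only on channels inside one system or between two
    interfaces, which preserves the channel clause of \<open>well_formed\<close>.\<close>
  from this x(1) have "(\<exists>i \<in> I. chan l \<in> channels (parts (Sys i))) \<or> gateway_channel (chan l)"
  proof (cases rule: transition_cases)
    case (external i l0)
    then show ?thesis
      by (cases "chan l0") (auto simp: gateway_channel_def chan_map_action channels_def)
  qed auto
  then have chans: "(\<exists>i \<in> I. e \<in> channels (parts (Sys i))) \<or> gateway_channel e" if "w' e \<noteq> []" for e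
  proof (cases "e = chan l")
    case False
    then have "w e \<noteq> []" using that effect_other[OF l(2)] by simp
    then show ?thesis using step(3) c by (cases e) (simp add: well_formed_def)
  qed simp
  have "q' p \<in> range Orig \<or> p = h i \<and> (\<exists>l y. is_send l \<and> (q' p, l, y) \<in> delta (mach MC p))"
    if i: "i \<in> I" and p: "p \<in> parts (Sys i)" for i p
  proof (cases "p = subject l")
    case False
    then show ?thesis using step(3) c x(2) i p by (auto simp: well_formed_def)
  next
    case True
    show ?thesis
    proof (cases "p = h i")
      case h: True
      then show ?thesis using gateway_hat_sends[OF i] x True by auto
    next
      case False
      then show ?thesis using local_delta[OF i p] x True by auto
    qed
  qed
  with chans show ?case by (auto simp: well_formed_def c)
qed

section \<open>Machine states in bad or stuck configurations\<close>

definition views where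
  "views c v u qK wK \<longleftrightarrow>
     (\<forall>i \<in> I. (v i, u i) \<in> RC (Sys i) \<and> sys_view i c (v i, u i)) \<and>
     (qK, wK) \<in> RC K \<and> pol_view c (qK, wK)"

lemma ex_views:
  assumes "c \<in> RC MC"
  shows "\<exists>v u qK wK. views c v u qK wK"
proof -
  have "\<forall>i\<in>I. \<exists>c'. c' \<in> RC (Sys i) \<and> sys_view i c c'"
    using sys_view_reachable[OF _ assms] by blast
  then obtain f where "\<And>i. i \<in> I \<Longrightarrow> f i \<in> RC (Sys i) \<and> sys_view i c (f i)"
    by metis
  moreover obtain c' where "c' \<in> RC K" "pol_view c c'"
    using pol_view_reachable[OF assms] by blast
  ultimately have "views c (\<lambda>i. fst (f i)) (\<lambda>i. snd (f i)) (fst c') (snd c')"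
    by (simp add: views_def)
  then show ?thesis by blast
qed

lemma viewsD:
  assumes "views (q, w) v u qK wK"
  shows "\<And>i. i \<in> I \<Longrightarrow> (v i, u i) \<in> RC (Sys i)"
    and "\<And>i p. i \<in> I \<Longrightarrow> p \<in> parts (Sys i) \<Longrightarrow> v i p = sys_state (q p)"
    and "\<And>i e. i \<in> I \<Longrightarrow> e \<in> channels (parts (Sys i)) \<Longrightarrow> u i e = w e"
    and "(qK, wK) \<in> RC K"
    and "\<And>i. i \<in> I \<Longrightarrow> qK (k i) = pol_state (q (h i))"
    and "\<And>i j. i \<in> I \<Longrightarrow> j \<in> I \<Longrightarrow> i \<noteq> j \<Longrightarrow> wK (k i, k j) = w (h i, h j)"
  using assms by (simp_all add: views_def sys_view_def pol_view_def)

lemma state_cases: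
  assumes "(q, w) \<in> RC MC" "i \<in> I" "p \<in> parts (Sys i)"
  obtains "q p = Orig (sys_state (q p))"
    | l x where "p = h i" "is_send l" "(q p, l, x) \<in> delta (mach MC p)"
proof -
  have "q p \<in> range Orig \<or> p = h i \<and> (\<exists>l x. is_send l \<and> (q p, l, x) \<in> delta (mach MC p))"
    using well_formed_reachable[OF assms(1)] assms(2,3) by (simp add: well_formed_def)
  then show thesis
  proof (elim disjE conjE exE)
    assume "q p \<in> range Orig"
    then show thesis by (intro that(1)) auto
  qed (rule that(2))
qed

text \<open>A gateway halfway through a relay offers an output, which a receiving state
  excludes.\<close>

lemma orig_if_receiving:
  assumes "(q, w) \<in> RC MC" "i \<in> I" "p \<in> parts (Sys i)" "receiving (mach MC p) (q p)"
  shows "q p = Orig (sys_state (q p))"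
  using assms(1-3)
proof (cases rule: state_cases)
  case (2 l x)
  then show ?thesis using assms(4) by (auto simp: receiving_def is_send_def)
qed

lemma orig_if_final:
  assumes "(q, w) \<in> RC MC" "i \<in> I" "p \<in> parts (Sys i)" "final (mach MC p) (q p)"
  shows "q p = Orig (sys_state (q p))"
  using assms(1-3) by (cases rule: state_cases) (use assms(4) in \<open>auto simp: final_def\<close>)

text \<open>Channels are unbounded, so an output is never blocked and a gateway halfway through a
  relay could always move.\<close>

lemma orig_if_stuck:
  assumes "(q, w) \<in> RC MC" "i \<in> I" "p \<in> parts (Sys i)" "\<nexists>l c. step MC (q, w) l c"
  shows "q p = Orig (sys_state (q p))"
  using assms(1-3)
proof (cases rule: state_cases)
  case (2 l x)
  have p: "p \<in> parts MC" using assms by (auto simp: parts_MC)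
  obtain s r a where l: "l = Send s r a" using 2 by (auto simp: is_send_def)
  have "subject l = p \<and> chan l \<in> channels (parts MC)"
    using p 2(3)
  proof (cases rule: transition_cases)
    case (internal i)
    then show ?thesis using channels_sys_MC by blast
  next
    case (external i l0)
    moreover from external obtain i1 i2 where "chan l0 = (i1, i2)" "i1 \<in> I" "i2 \<in> I" "i1 \<noteq> i2"
      by (auto simp: channels_def)
    ultimately show ?thesis using channels_h_MC by (simp add: subject_map_action chan_map_action)
  qed
  then have "\<exists>c. step MC (q, w) l c"
    using 2 l by (auto simp: step_iff intro: step.send)
  then show ?thesis using assms(4) by blast
qed

lemma local_final:
  "i \<in> I \<Longrightarrow> p \<in> parts (Sys i) \<Longrightarrow> final (mach MC p) (Orig x) \<longleftrightarrow> final (mach (Sys i) p) x"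
  by (cases "p = h i")
    (auto simp: gateway_final local_delta final_def[of "mach MC p"] final_def[of "mach (Sys i) p"])

text \<open>Interfaces are excluded because every gateway action at an \<open>Orig\<close> state is
  an input, even where the interface itself would send.\<close>

lemma local_receiving:
  "i \<in> I \<Longrightarrow> p \<in> parts (Sys i) \<Longrightarrow> p \<noteq> h i \<Longrightarrow>
     receiving (mach MC p) (Orig x) \<longleftrightarrow> receiving (mach (Sys i) p) x"
  by (auto simp: receiving_def local_final local_delta)

text \<open>By the exchange of polarity, an interface about to send is, for the policy, waiting for
  the message to arrive from another gateway.\<close>

lemma receiving_N: "i \<in> I \<Longrightarrow> receiving (N i) (Dot q) \<longleftrightarrow> sending (M i) q"
  using N_polarity(1)[of i q] unfolding receiving_def sending_def
  by (metis action.exhaust_disc action.distinct_disc(1) final_N)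

text \<open>The absence of mixed states enters here; it applies because a state with an outgoing
  transition belongs to \<open>states (M i)\<close>.\<close>

lemma sending_or_receiving:
  assumes "i \<in> I" "no_mixed_states (M i)" "\<not> final (M i) q"
  shows "sending (M i) q \<or> receiving (M i) q"
proof -
  have "q \<in> states (M i)"
    using assms(3) cfsm_states[OF cfsm_M[OF assms(1)]] by (auto simp: final_def)
  then show ?thesis
    using assms(2,3) unfolding no_mixed_states_def mixed_def sending_def receiving_def
    by (meson action.exhaust_disc)
qed

section \<open>Transfer of the four properties to the composition\<close>

lemma deadlock_free_MC:
  assumes nm: "\<And>i. i \<in> I \<Longrightarrow> no_mixed_states (M i)"
    and df: "\<And>i. i \<in> I \<Longrightarrow> deadlock_free (Sys i)" and dfK: "deadlock_free K"
  shows "deadlock_free MC"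
  unfolding deadlock_free_def
proof (intro ballI notI)
  fix c assume c: "c \<in> RC MC" and d: "deadlock MC c"
  obtain q w where qw: "c = (q, w)" by (cases c)
  note c = c[unfolded qw]
  obtain v u qK wK where "views (q, w) v u qK wK" using ex_views[OF c] by blast
  note v = viewsD(1-3)[OF this] and K = viewsD(4-6)[OF this]
  have w: "w e = []" if "e \<in> channels (parts MC)" for e
    using d that by (auto simp: deadlock_def qw)
  have rec: "receiving (mach MC p) (q p)" "q p = Orig (sys_state (q p))"
    if "i \<in> I" "p \<in> parts (Sys i)" for i p
  proof -
    show "receiving (mach MC p) (q p)" using d that by (auto simp: deadlock_def qw parts_MC)
    then show "q p = Orig (sys_state (q p))" using orig_if_receiving[OF c that] by blast
  qed
  \<comment> \<open>An interface that is not sending would be receiving, and then the whole view of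
    \<open>Sys i\<close> would be a deadlock.\<close>
  have "sending (M i) (sys_state (q (h i)))" if i: "i \<in> I" for i
  proof (rule ccontr)
    assume ns: "\<not> sending (M i) (sys_state (q (h i)))"
    have "\<not> final (M i) (sys_state (q (h i)))"
      using rec[OF i h_parts[OF i]] gateway_final[OF i] by (metis receiving_def)
    with ns have r: "receiving (M i) (sys_state (q (h i)))"
      using sending_or_receiving[OF i nm[OF i]] by blast
    have "receiving (mach (Sys i) p) (v i p)" if p: "p \<in> parts (Sys i)" for p
      using r rec[OF i p] local_receiving[OF i p] v(2)[OF i p] by (cases "p = h i") metis+
    then have "deadlock (Sys i) (v i, u i)"
      using v(3)[OF i] w channels_sys_MC[OF i] by (auto simp: deadlock_def)
    then show False using df[OF i] v(1)[OF i] by (auto simp: deadlock_free_def)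
  qed
  \<comment> \<open>With all interfaces about to send, all dotted machines wait for each other on
    empty channels: a deadlock of \<open>K\<close>.\<close>
  then have "receiving (N i) (qK (k i))" if "i \<in> I" for i
    using receiving_N[OF that] rec(2)[OF that h_parts[OF that]] K(2)[OF that] that
    by (metis pol_state.simps(1))
  moreover have "wK e = []" if "e \<in> channels (k ` I)" for e
    using that K(3) w channels_h_MC by (auto simp: channels_def[of "k ` I"])
  ultimately have "deadlock K (qK, wK)"
    by (auto simp: deadlock_def parts_K)
  then show False using dfK K(1) by (auto simp: deadlock_free_def)
qed

text \<open>An orphan message lies inside some \<open>Sys i\<close> or between two interfaces, which
  selects the view. Finality of an \<open>Orig\<close> state is the same in all readings, even at
  mixed states, so that view is an orphan-message configuration.\<close>

lemma orphan_message_free_MC: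
  assumes of: "\<And>i. i \<in> I \<Longrightarrow> orphan_message_free (Sys i)" and ofK: "orphan_message_free K"
  shows "orphan_message_free MC"
  unfolding orphan_message_free_def
proof (intro ballI notI)
  fix c assume c: "c \<in> RC MC" and d: "orphan_message MC c"
  obtain q w where qw: "c = (q, w)" by (cases c)
  note c = c[unfolded qw]
  obtain v u qK wK where "views (q, w) v u qK wK" using ex_views[OF c] by blast
  note v = viewsD(1-3)[OF this] and K = viewsD(4-6)[OF this]
  have fin: "q p = Orig (sys_state (q p))" "final (mach (Sys i) p) (sys_state (q p))"
    if i: "i \<in> I" and p: "p \<in> parts (Sys i)" for i p
  proof -
    have f: "final (mach MC p) (q p)"
      using d i p by (auto simp: orphan_message_def all_final_def qw parts_MC)
    then show "q p = Orig (sys_state (q p))" using orig_if_final[OF c i p] by blast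
    then show "final (mach (Sys i) p) (sys_state (q p))" using local_final[OF i p] f by metis
  qed
  obtain e where e: "w e \<noteq> []" using d by (auto simp: orphan_message_def qw)
  then consider i where "i \<in> I" "e \<in> channels (parts (Sys i))" | "gateway_channel e"
    using well_formed_reachable[OF c] unfolding well_formed_def snd_conv by metis
  then show False
  proof cases
    case (1 i)
    then have "orphan_message (Sys i) (v i, u i)"
      using v(2,3) fin(2) e by (auto simp: orphan_message_def all_final_def)
    then show False using of[OF 1(1)] v(1)[OF 1(1)] by (auto simp: orphan_message_free_def)
  next
    case 2
    then obtain i j where ij: "i \<in> I" "j \<in> I" "i \<noteq> j" "e = (h i, h j)"
      by (auto simp: gateway_channel_def)
    then have "wK (k i, k j) \<noteq> []" "(k i, k j) \<in> channels (parts K)"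
      using K(3) e by (auto simp: parts_K channels_def k_eq_iff)
    moreover have "final (N i) (qK (k i))" if "i \<in> I" for i
      using fin[OF that h_parts[OF that]] final_N[OF that] K(2)[OF that] by (metis pol_state.simps(1))
    ultimately have "orphan_message K (qK, wK)"
      by (auto simp: orphan_message_def all_final_def parts_K)
    then show False using ofK K(1) by (auto simp: orphan_message_free_def)
  qed
qed

text \<open>The machine \<open>r\<close> at fault selects the view: the system owning it, unless
  \<open>r\<close> is an interface in a sending state, when the failing inputs are those of its
  dotted copy.\<close>

lemma reception_error_free_MC:
  assumes nm: "\<And>i. i \<in> I \<Longrightarrow> no_mixed_states (M i)"
    and rf: "\<And>i. i \<in> I \<Longrightarrow> reception_error_free (Sys i)" and rfK: "reception_error_free K"
  shows "reception_error_free MC"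
  unfolding reception_error_free_def
proof (intro ballI notI)
  fix c assume c: "c \<in> RC MC" and d: "unspecified_reception MC c"
  obtain q w where qw: "c = (q, w)" by (cases c)
  note c = c[unfolded qw]
  obtain v u qK wK where "views (q, w) v u qK wK" using ex_views[OF c] by blast
  note v = viewsD(1-3)[OF this] and K = viewsD(4-6)[OF this]
  obtain r where r: "r \<in> parts MC" "receiving (mach MC r) (q r)"
    and "\<forall>s a y. (q r, Recv s r a, y) \<in> delta (mach MC r) \<longrightarrow>
      w (s, r) \<noteq> [] \<and> w (s, r) \<notin> {a # u | u. u \<in> lists (msgs MC)}"
    using d unfolding unspecified_reception_def qw prod.case length_greater_0_conv by blast
  note bad = this(3)[rule_format]
  obtain i where i: "i \<in> I" "r \<in> parts (Sys i)" using r(1) by (auto simp: parts_MC)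
  let ?x = "sys_state (q r)"
  have x: "q r = Orig ?x" using orig_if_receiving[OF c i r(2)] .
  \<comment> \<open>Shared by ordinary participants and receiving interfaces: if every input of
    \<open>r\<close> in \<open>Sys i\<close> is also offered in the composition, the error appears
    in the view.\<close>
  have sys: False if rec: "receiving (mach (Sys i) r) ?x"
    and tr: "\<And>s a y. (?x, Recv s r a, y) \<in> delta (mach (Sys i) r) \<Longrightarrow>
      \<exists>y'. (q r, Recv s r a, y') \<in> delta (mach MC r)"
  proof -
    have "u i (s, r) \<noteq> [] \<and> u i (s, r) \<notin> {a # u | u. u \<in> lists (msgs (Sys i))}"
      if t: "(?x, Recv s r a, y) \<in> delta (mach (Sys i) r)" for s a y
    proof -
      have "u i (s, r) = w (s, r)" using cfsm_chan[OF cfsm_sys[OF i] t] v(3)[OF i(1)] by simp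
      moreover have "w (s, r) \<noteq> [] \<and> w (s, r) \<notin> {a # u | u. u \<in> lists (msgs MC)}"
        using tr[OF t] bad by blast
      \<comment> \<open>\<open>unspecified_reception\<close> refers to the alphabet of the system;
        avoiding the words with head \<open>a\<close> over the larger alphabet implies avoiding
        those over \<open>msgs (Sys i)\<close>.\<close>
      moreover have "lists (msgs (Sys i)) \<subseteq> lists (msgs MC)"
        using i(1) by (intro lists_mono) (auto simp: msgs_MC)
      ultimately show ?thesis by auto
    qed
    then have "unspecified_reception (Sys i) (v i, u i)"
      using unspecified_receptionI[OF i(2), of "v i"] rec unfolding v(2)[OF i] by blast
    then show False using rf[OF i(1)] v(1)[OF i(1)] by (auto simp: reception_error_free_def)
  qed
  show False
  proof (cases "r = h i")
    case False
    show False
    proof (rule sys)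
      show "receiving (mach (Sys i) r) ?x" using r(2) x local_receiving[OF i False] by metis
    next
      fix s a y assume "(?x, Recv s r a, y) \<in> delta (mach (Sys i) r)"
      then show "\<exists>y'. (q r, Recv s r a, y') \<in> delta (mach MC r)"
        using local_delta[OF i False] x by metis
    qed
  next
    case True
    have "\<not> final (M i) ?x"
      using r(2) x gateway_final[OF i(1)] True by (metis receiving_def)
    then consider "sending (M i) ?x" | "receiving (M i) ?x"
      using sending_or_receiving[OF i(1) nm[OF i(1)]] by blast
    then show False
    proof cases
      case 1
      have qK: "qK (k i) = Dot ?x" using K(2)[OF i(1)] x True by (metis pol_state.simps(1))
      have "wK (s, k i) \<noteq> [] \<and> wK (s, k i) \<notin> {a # u | u. u \<in> lists (msgs K)}"
        if t: "(Dot ?x, Recv s (k i) a, y) \<in> delta (N i)" for s a y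
      proof -
        obtain j where j: "s = k j" "j \<in> I" "j \<noteq> i" using t by (cases rule: delta_N_cases[OF i(1)]) auto
        \<comment> \<open>The gateway offers the same input under the names \<open>h\<close>, so
          \<open>bad\<close> applies to the channel whose content the policy view copies.\<close>
        then obtain y' where "(q r, Recv (h j) r a, y') \<in> delta (mach MC r)"
          using gateway_recv_N[OF i(1) j(2)] t x True by metis
        from bad[OF this] show ?thesis using K(3)[OF j(2) i(1) j(3)] j True msgs_K by simp
      qed
      then have "unspecified_reception K (qK, wK)"
        using i(1) qK receiving_N[OF i(1)] 1 parts_K
        by (intro unspecified_receptionI[of "k i"]) simp_all
      then show False using rfK K(1) by (auto simp: reception_error_free_def)
    next
      case 2
      show False
      proof (rule sys)
        show "receiving (mach (Sys i) r) ?x" using 2 True by simp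
      next
        fix s a y assume "(?x, Recv s r a, y) \<in> delta (mach (Sys i) r)"
        then show "\<exists>y'. (q r, Recv s r a, y') \<in> delta (mach MC r)"
          using gateway_recv[OF i(1)] x True by metis
      qed
    qed
  qed
qed

text \<open>In a stuck configuration that is not final, some \<open>Sys i\<close> can still step in
  its view, but only by an output of its interface. That interface is then sending, so
  \<open>K\<close> is not final either and can step in its view. An input of \<open>K\<close> would
  be a step of the composition, and an output of \<open>K\<close> would stem from an interface that
  is not sending.\<close>

lemma progress_MC:
  assumes nm: "\<And>i. i \<in> I \<Longrightarrow> no_mixed_states (M i)"
    and pr: "\<And>i. i \<in> I \<Longrightarrow> progress (Sys i)" and prK: "progress K"
  shows "progress MC"
  unfolding progress_def
proof (intro ballI, rule disjCI)
  fix c assume c: "c \<in> RC MC" and nf: "\<not> all_final MC c"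
  obtain q w where qw: "c = (q, w)" by (cases c)
  note c = c[unfolded qw]
  obtain v u qK wK where "views (q, w) v u qK wK" using ex_views[OF c] by blast
  note v = viewsD(1-3)[OF this] and K = viewsD(4-6)[OF this]
  show "\<exists>l c'. step MC c l c'"
  proof (rule ccontr)
    assume "\<not> ?thesis"
    then have stuck: "\<nexists>l c'. step MC (q, w) l c'" by (simp add: qw)
    let ?x = "\<lambda>p. sys_state (q p)"
    have orig: "q p = Orig (?x p)" if "i \<in> I" "p \<in> parts (Sys i)" for i p
      using orig_if_stuck[OF c that stuck] .
    \<comment> \<open>Any other step of \<open>Sys i\<close> would also be a step of the composition.\<close>
    have sends: "sending (M i) (?x (h i))"
      if i: "i \<in> I" and p: "p \<in> parts (Sys i)" "\<not> final (mach (Sys i) p) (?x p)" for i p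
    proof -
      have "\<not> all_final (Sys i) (v i, u i)" using p v(2)[OF i] by (auto simp: all_final_def)
      then obtain l v' u' where "step (Sys i) (v i, u i) l (v', u')"
        using pr[OF i] v(1)[OF i] by (auto simp: progress_def)
      then obtain y where l: "chan l \<in> channels (parts (Sys i))" "effect l (u i) u'"
        and y: "(v i (subject l), l, y) \<in> delta (mach (Sys i) (subject l))"
        by (auto simp: step_iff)
      have s: "subject l \<in> parts (Sys i)" using l(1) subject_in_chan[of l] by (auto simp: channels_def)
      note y = y[unfolded v(2)[OF i s]]
      have ch: "chan l \<in> channels (parts MC)" by (rule channels_sys_MC[OF i l(1)])
      have eff: "effect l w (w(chan l := u' (chan l)))"
        using effect_cong[OF l(2)] v(3)[OF i l(1)] by simp
      have no: "(q (subject l), l, y') \<notin> delta (mach MC (subject l))" for y'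
        using stuck ch eff by (auto simp: step_iff)
      \<comment> \<open>Every participant other than the interface is embedded unchanged, so its
        transition would be available in the composition.\<close>
      have si: "subject l = h i"
        using no y orig[OF i s] local_delta[OF i s] by metis
      \<comment> \<open>An input of the interface would be available too, as the first half of a
        relay.\<close>
      have "is_send l"
      proof (cases l)
        case (Recv s' r a)
        then show ?thesis using no y gateway_recv[OF i] orig[OF i s] si by (metis subject.simps(2))
      qed simp
      then have "\<not> receiving (M i) (?x (h i))" "\<not> final (M i) (?x (h i))"
        using y si unfolding receiving_def final_def
        by (metis action.distinct_disc(1))+
      then show ?thesis using sending_or_receiving[OF i nm[OF i]] by blast
    qed
    obtain p i where p: "\<not> final (mach MC p) (q p)" and i: "i \<in> I" "p \<in> parts (Sys i)"
      using nf by (auto simp: all_final_def qw parts_MC)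
    have "\<not> final (mach (Sys i) p) (?x p)"
      using p local_final[OF i] orig[OF i] by metis
    note i = i this
    have qK: "qK (k j) = Dot (?x (h j))" if "j \<in> I" for j
      using K(2)[OF that] orig[OF that h_parts[OF that]] by (metis pol_state.simps(1))
    have "\<not> final (N i) (qK (k i))"
      using sends[OF i] qK[OF i(1)] final_N[OF i(1)] by (simp add: sending_def)
    then have "\<not> all_final K (qK, wK)" using i(1) by (auto simp: all_final_def parts_K)
    then obtain l v' u' where "step K (qK, wK) l (v', u')"
      using prK K(1) by (auto simp: progress_def)
    then obtain y where l: "chan l \<in> channels (k ` I)" "effect l wK u'"
      and y: "(qK (subject l), l, y) \<in> delta (mach K (subject l))"
      by (auto simp: step_iff parts_K)
    obtain j where j: "j \<in> I" "subject l = k j"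
      using l(1) subject_in_chan[of l] by (auto simp: channels_def)
    note y = y[unfolded j(2) qK[OF j(1)]]
    from j(1) y show False
    proof (cases rule: delta_N_cases)
      \<comment> \<open>A dotted output mirrors an input of \<open>M j\<close>, which contradicts
        \<open>sends\<close> applied to the interface itself.\<close>
      case (send x j' a x' r)
      then have "\<not> final (M j) (?x (h j))" "\<not> sending (M j) (?x (h j))"
        unfolding final_def sending_def by auto
      then show False using sends[OF j(1) h_parts[OF j(1)]] by blast
    next
      case (recv x j' a x' r)
      \<comment> \<open>The gateway offers the mirrored input, and its message is at the head of the
        channel, since \<open>wK\<close> copies that channel.\<close>
      then obtain y' where "(q (h j), Recv (h j') (h j) a, y') \<in> delta (mach MC (h j))"
        using gateway_recv_N[OF j(1)] y orig[OF j(1) h_parts[OF j(1)]] by metis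
      moreover have "(h j', h j) \<in> channels (parts MC)"
        using channels_h_MC recv j by blast
      moreover obtain t where "w (h j', h j) = a # t" using l(2) recv K(3) j by auto
      ultimately show False using stuck step.recv by metis
    qed
  qed
qed

end

theorem theorem5p1:
  fixes I :: "'i set"
    and Sys :: "'i \<Rightarrow> ('q, 'p, 'm) system"
    and h k :: "'i \<Rightarrow> 'p"
    and CM :: "('p \<times> 'm \<times> 'p) set"
    and K :: "('q dotted, 'p, 'm) system"
    and S :: "(('q, 'p, 'm) gstate, 'p, 'm) system"
  assumes "finite I"
    and "\<And>i. i \<in> I \<Longrightarrow> communicating_system (Sys i)"
    and "disjoint_family_on (\<lambda>i. parts (Sys i)) I"
    and "\<And>i. i \<in> I \<Longrightarrow> h i \<in> parts (Sys i)"
    and "inj_on k I"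
    and "k ` I \<inter> (\<Union>i \<in> I. parts (Sys i)) = {}"
    and "connection_model I Sys h CM"
    and "connection_policy I Sys h k CM K"
    and "S = multicomposition I Sys h k K"
  shows "((\<forall>i \<in> I. no_mixed_states (interface_machine Sys h i)) \<longrightarrow>
            ((\<forall>i \<in> I. deadlock_free (Sys i)) \<and> deadlock_free K \<longrightarrow> deadlock_free S) \<and>
            ((\<forall>i \<in> I. reception_error_free (Sys i)) \<and> reception_error_free K
               \<longrightarrow> reception_error_free S) \<and>
            ((\<forall>i \<in> I. progress (Sys i)) \<and> progress K \<longrightarrow> progress S)) \<and>
         ((\<forall>i \<in> I. orphan_message_free (Sys i)) \<and> orphan_message_free K
            \<longrightarrow> orphan_message_free S)"
proof -
  interpret multicomp I Sys h k CM K
    by unfold_locales (use assms in auto)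
  show ?thesis
    unfolding assms(9) interface_machine_def
    using deadlock_free_MC reception_error_free_MC progress_MC orphan_message_free_MC by blast
qed

end
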